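(* Let $m \geq 1$ and $k \geq 2$ be integers, let $G$ be a complete multipartite graph, and let $w$ and $w'$ be $m$-weightings of $G$ such that $w'$ is uniform-$\alpha$. Then $\pi_k(G(w')) \leq \pi_k(G(w))$.
   Context: All graphs are simple. $\mathbb{N}_0 = \{0,1,2,\dots\}$, $[n]=\{1,\dots,n\}$. For a graph $G$, a function $w: V(G) \to \mathbb{N}_0$ with $\sum_{v \in V(G)} w(v) = m$ is an $m$-weighting of $G$. $G(w)$ is the graph obtained from $G$ by replacing each vertex $v$ by a clique $K^v$ on $w(v)$ vertices and joining every vertex of $K^u$ to every vertex of $K^v$ whenever $uv \in E(G)$. $\pi_k(H)$ denotes the number of $k$-cliques of a graph $H$. For $U \subseteq V(G)$, an $m$-weighting $w$ is uniform on $U$ if $w(v)=0$ for all $v \notin U$ and $w(u) \in \{\lfloor m/|U|\rfloor, \lceil m/|U| \rceil\}$ for all $u \in U$; $w$ is uniform-$\alpha$ if it is uniform on some independent set of $G$ of maximum size. A complete multipartite graph is a graph whose vertex set is the union of pairwise disjoint non-empty sets $I_1,\dots,I_r$ (its maximal partite sets), with $xy$ an edge iff $x$ and $y$ lie in different sets $I_i$, $I_j$. *)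

theory Defs
  imports "Graph_Theory.Pair_Digraph" "HOL-Library.Disjoint_Sets" Complex_Main
begin

text \<open>A finite simple graph is a \<^locale>\<open>pair_graph\<close>: \<^const>\<open>parcs\<close> is a symmetric, irreflexive relation
  on a finite vertex set, so that an edge $uv$ is present as both $(u,v)$ and $(v,u)$.\<close>

definition complete_multipartite :: "'a pair_pre_digraph \<Rightarrow> bool" where
  "complete_multipartite G \<longleftrightarrow> pair_graph G \<and>
     (\<exists>P. partition_on (pverts G) P \<and>
        (\<forall>x\<in>pverts G. \<forall>y\<in>pverts G.
           (x, y) \<in> parcs G \<longleftrightarrow> (\<exists>I\<in>P. \<exists>J\<in>P. I \<noteq> J \<and> x \<in> I \<and> y \<in> J)))"

text \<open>Weightings are total functions on the vertex type; only their values on \<^term>\<open>pverts G\<close> matter.\<close>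

definition weighting :: "'a pair_pre_digraph \<Rightarrow> nat \<Rightarrow> ('a \<Rightarrow> nat) \<Rightarrow> bool" where
  "weighting G m w \<longleftrightarrow> (\<Sum>v\<in>pverts G. w v) = m"

text \<open>The clique $K^v$ has the vertices $(v,0),\dots,(v,w(v)-1)$.\<close>

definition blow_up :: "'a pair_pre_digraph \<Rightarrow> ('a \<Rightarrow> nat) \<Rightarrow> ('a \<times> nat) pair_pre_digraph" where
  "blow_up G w =
     (let V = {(v, i). v \<in> pverts G \<and> i < w v}
      in \<lparr> pverts = V,
           parcs = {(x, y). x \<in> V \<and> y \<in> V \<and> x \<noteq> y \<and>
                            (fst x = fst y \<or> (fst x, fst y) \<in> parcs G)} \<rparr>)"

definition is_clique :: "'a pair_pre_digraph \<Rightarrow> 'a set \<Rightarrow> bool" where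
  "is_clique H S \<longleftrightarrow> S \<subseteq> pverts H \<and> (\<forall>x\<in>S. \<forall>y\<in>S. x \<noteq> y \<longrightarrow> (x, y) \<in> parcs H)"

definition num_cliques :: "nat \<Rightarrow> 'a pair_pre_digraph \<Rightarrow> nat" where
  "num_cliques k H = card {S. is_clique H S \<and> finite S \<and> card S = k}"

definition independent_set :: "'a pair_pre_digraph \<Rightarrow> 'a set \<Rightarrow> bool" where
  "independent_set G S \<longleftrightarrow> S \<subseteq> pverts G \<and> (\<forall>x\<in>S. \<forall>y\<in>S. (x, y) \<notin> parcs G)"

definition maximum_independent_set :: "'a pair_pre_digraph \<Rightarrow> 'a set \<Rightarrow> bool" where
  "maximum_independent_set G S \<longleftrightarrow>
     independent_set G S \<and> (\<forall>T. independent_set G T \<longrightarrow> card T \<le> card S)"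

definition uniform_on :: "'a pair_pre_digraph \<Rightarrow> nat \<Rightarrow> 'a set \<Rightarrow> ('a \<Rightarrow> nat) \<Rightarrow> bool" where
  "uniform_on G m U w \<longleftrightarrow>
     U \<subseteq> pverts G \<and> weighting G m w \<and>
     (\<forall>v\<in>pverts G - U. w v = 0) \<and>
     (\<forall>u\<in>U. int (w u) \<in> {\<lfloor>real m / real (card U)\<rfloor>, \<lceil>real m / real (card U)\<rceil>})"

definition uniform_alpha :: "'a pair_pre_digraph \<Rightarrow> nat \<Rightarrow> ('a \<Rightarrow> nat) \<Rightarrow> bool" where
  "uniform_alpha G m w \<longleftrightarrow> (\<exists>U. maximum_independent_set G U \<and> uniform_on G m U w)"

end

theory Submission
  imports Defs
begin

text \<open>Let \<open>U\<close> be a maximum independent set. Every partite set has at most \<open>|U|\<close> vertices, so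
  there is a map from the vertices to \<open>U\<close> that is injective on each partite set; two distinct vertices
  with the same image are then adjacent. Hence, in \<open>G(w)\<close>, all copies of all vertices with a given
  image form a clique, and pushing the weight of \<open>w\<close> forward to \<open>U\<close> does not create cliques.
  On \<open>U\<close> the number of \<open>k\<close>-cliques is a sum of binomial coefficients, which is smallest for
  the balanced weighting by convexity.\<close>

text \<open>Discrete convexity: by Pascal's rule the increments of \<open>n choose Suc k\<close> are
  \<open>n choose k\<close>, which is monotone in \<open>n\<close>, so the sequence lies above the
  line through its value at \<open>q\<close> with slope \<open>q choose k\<close>. The integers are
  used because the line may descend below \<open>q\<close> or become negative.\<close>

lemma binomial_ge_tangent:
  "int (n choose Suc k) \<ge> int (q choose Suc k) + (int n - int q) * int (q choose k)"
proof (cases "q \<le> n")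
  case True
  then show ?thesis
  proof (induction n rule: dec_induct)
    case (step n)
    have "q choose k \<le> n choose k"
      using step.hyps by (intro binomial_right_mono) simp
    then show ?case using step.IH by (simp add: algebra_simps)
  qed simp
next
  case False
  then have "n \<le> q" by simp
  then show ?thesis
  proof (induction n rule: inc_induct)
    \<comment> \<open>Going down from \<open>Suc n\<close> to \<open>n\<close> lowers the binomial
      by \<open>n choose k\<close> and the line by \<open>q choose k\<close>, which is at least as
      much.\<close>
    case (step n)
    have "n choose k \<le> q choose k"
      using step.hyps by (intro binomial_right_mono) simp
    then show ?case using step.IH by (simp add: algebra_simps)
  qed simp
qed

text \<open>The total height of the tangent line over \<open>U\<close> depends only on the total
  weight, so it is the same for \<open>a\<close> and \<open>b\<close>. It is the exact count for
  \<open>a\<close> and a lower bound for \<open>b\<close>.\<close>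

lemma sum_binomial_balanced_le:
  fixes a b :: "'a \<Rightarrow> nat"
  assumes "sum a U = sum b U" and balanced: "\<And>u. u \<in> U \<Longrightarrow> a u \<in> {q, Suc q}"
  shows "(\<Sum>u\<in>U. a u choose Suc k) \<le> (\<Sum>u\<in>U. b u choose Suc k)"
proof -
  let ?t = "\<lambda>n. int (q choose Suc k) + (int n - int q) * int (q choose k)"
  have sum_tangent: "(\<Sum>u\<in>U. ?t (c u)) =
      int (card U) * int (q choose Suc k) + (int (sum c U) - int (card U) * int q) * int (q choose k)"
    for c :: "'a \<Rightarrow> nat"
    by (simp add: sum.distrib sum_subtractf flip: sum_distrib_right)
  \<comment> \<open>The line meets the binomial at both \<open>q\<close> and \<open>Suc q\<close>,
    the latter by Pascal's rule.\<close>
  have "int (\<Sum>u\<in>U. a u choose Suc k) = (\<Sum>u\<in>U. ?t (a u))"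
    unfolding of_nat_sum by (rule sum.cong) (use balanced in force)+
  also have "\<dots> = (\<Sum>u\<in>U. ?t (b u))"
    using assms(1) by (simp only: sum_tangent)
  also have "\<dots> \<le> int (\<Sum>u\<in>U. b u choose Suc k)"
    unfolding of_nat_sum by (intro sum_mono binomial_ge_tangent)
  finally show ?thesis by (simp only: of_nat_le_iff)
qed

text \<open>Turns the real floor and ceiling into two consecutive naturals, the form that the
  convexity bound takes; the ceiling exceeds the floor by at most one.\<close>

lemma uniform_on_balanced:
  assumes "uniform_on G m U w" "u \<in> U"
  shows "w u \<in> {m div card U, Suc (m div card U)}"
proof -
  have "\<lfloor>real m / real (card U)\<rfloor> = int (m div card U)"
    by (rule floor_divide_of_nat_eq)
  moreover have "int (w u) = \<lfloor>real m / real (card U)\<rfloor> \<or> int (w u) = \<lceil>real m / real (card U)\<rceil>"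
    using assms by (auto simp: uniform_on_def)
  ultimately show ?thesis
    using ceiling_diff_floor_le_1[of "real m / real (card U)"]
      floor_le_ceiling[of "real m / real (card U)"] by auto
qed

lemma pverts_blow_up: "pverts (blow_up G w) = Sigma (pverts G) (\<lambda>v. {..<w v})"
  by (auto simp: blow_up_def Let_def)

lemma parcs_blow_up_iff:
  "(x, y) \<in> parcs (blow_up G w) \<longleftrightarrow> x \<in> pverts (blow_up G w) \<and> y \<in> pverts (blow_up G w) \<and>
     x \<noteq> y \<and> (fst x = fst y \<or> (fst x, fst y) \<in> parcs G)"
  by (simp add: blow_up_def Let_def)

text \<open>Copies of distinct vertices of an independent set are not adjacent, so a nonempty clique
  stays above a single vertex of \<open>U\<close>.\<close>

lemma num_cliques_blow_up_independent_le:
  assumes "finite U" and indep: "independent_set G U"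
    and supp: "\<And>v. v \<in> pverts G - U \<Longrightarrow> w v = 0" and "k > 0"
  shows "num_cliques k (blow_up G w) \<le> (\<Sum>u\<in>U. w u choose k)"
proof -
  let ?C = "\<lambda>u. {S. S \<subseteq> {u} \<times> {..<w u} \<and> card S = k}"
  have fin: "finite (?C u)" for u
    by (rule finite_subset[of _ "Pow ({u} \<times> {..<w u})"]) auto
  have "{S. is_clique (blow_up G w) S \<and> finite S \<and> card S = k} \<subseteq> (\<Union>u\<in>U. ?C u)"
  proof
    fix S assume "S \<in> {S. is_clique (blow_up G w) S \<and> finite S \<and> card S = k}"
    then have clique: "is_clique (blow_up G w) S" and card: "card S = k" by auto
    have "S \<noteq> {}" using card \<open>k > 0\<close> by auto
    then obtain x where x: "x \<in> S" by auto
    have in_U: "fst y \<in> U \<and> snd y < w (fst y)" if "y \<in> S" for y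
    proof -
      have "y \<in> pverts (blow_up G w)"
        using clique that by (auto simp: is_clique_def)
      then show ?thesis using supp[of "fst y"] by (cases "fst y \<in> U") (auto simp: pverts_blow_up)
    qed
    have "fst y = fst x" if "y \<in> S" for y
    proof (cases "y = x")
      case False
      then have "(y, x) \<in> parcs (blow_up G w)"
        using clique that x by (auto simp: is_clique_def)
      moreover have "(fst y, fst x) \<notin> parcs G"
        using in_U[OF that] in_U[OF x] indep by (auto simp: independent_set_def)
      ultimately show ?thesis by (simp add: parcs_blow_up_iff)
    qed simp
    then have "S \<subseteq> {fst x} \<times> {..<w (fst x)}"
      using in_U by (force simp: mem_Times_iff)
    then show "S \<in> (\<Union>u\<in>U. ?C u)"
      using in_U[OF x] card by blast
  qed
  then have "num_cliques k (blow_up G w) \<le> card (\<Union>u\<in>U. ?C u)"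
    unfolding num_cliques_def using \<open>finite U\<close> fin by (intro card_mono) auto
  also have "\<dots> \<le> (\<Sum>u\<in>U. card (?C u))"
    by (rule card_UN_le[OF \<open>finite U\<close>])
  also have "\<dots> = (\<Sum>u\<in>U. w u choose k)"
    by (simp add: n_subsets card_cartesian_product)
  finally show ?thesis .
qed

text \<open>All copies above one fibre of \<open>\<phi>\<close> are pairwise adjacent, so each
  \<open>k\<close>-subset of them is a clique. Since \<open>k > 0\<close>, none is counted for two
  different fibres.\<close>

lemma num_cliques_blow_up_fibres_ge:
  assumes "finite (pverts G)" "finite U"
    and adj: "\<And>x y. \<lbrakk>x \<in> pverts G; y \<in> pverts G; x \<noteq> y; \<phi> x = \<phi> y\<rbrakk> \<Longrightarrow> (x, y) \<in> parcs G"
    and "k > 0"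
  shows "(\<Sum>u\<in>U. (\<Sum>v\<in>{v \<in> pverts G. \<phi> v = u}. w v) choose k) \<le> num_cliques k (blow_up G w)"
proof -
  let ?F = "\<lambda>u. Sigma {v \<in> pverts G. \<phi> v = u} (\<lambda>v. {..<w v})"
  let ?C = "\<lambda>u. {S. S \<subseteq> ?F u \<and> card S = k}"
  have finF: "finite (?F u)" for u
    using assms(1) by auto
  have fin: "finite (?C u)" for u
    using finF[of u] by simp
  have "?C u \<inter> ?C u' = {}" if "u \<noteq> u'" for u u'
  proof -
    have "S = {}" if "S \<subseteq> ?F u" "S \<subseteq> ?F u'" for S
      using that \<open>u \<noteq> u'\<close> by blast
    moreover have "{} \<notin> ?C u" using \<open>k > 0\<close> by simp
    ultimately show ?thesis by blast
  qed
  then have "card (\<Union>u\<in>U. ?C u) = (\<Sum>u\<in>U. card (?C u))"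
    using \<open>finite U\<close> fin by (intro card_UN_disjoint) auto
  also have "\<dots> = (\<Sum>u\<in>U. (\<Sum>v\<in>{v \<in> pverts G. \<phi> v = u}. w v) choose k)"
    using assms(1) by (intro sum.cong refl) (subst n_subsets[OF finF], simp)
  finally have "(\<Sum>u\<in>U. (\<Sum>v\<in>{v \<in> pverts G. \<phi> v = u}. w v) choose k) = card (\<Union>u\<in>U. ?C u)" ..
  also have "\<dots> \<le> num_cliques k (blow_up G w)"
    unfolding num_cliques_def
  proof (rule card_mono)
    have "{S. is_clique (blow_up G w) S \<and> finite S \<and> card S = k} \<subseteq> Pow (pverts (blow_up G w))"
      by (auto simp: is_clique_def)
    then show "finite {S. is_clique (blow_up G w) S \<and> finite S \<and> card S = k}"
      by (rule finite_subset) (simp add: pverts_blow_up assms(1))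
  next
    show "(\<Union>u\<in>U. ?C u) \<subseteq> {S. is_clique (blow_up G w) S \<and> finite S \<and> card S = k}"
    proof
      fix S assume "S \<in> (\<Union>u\<in>U. ?C u)"
      then obtain u where S: "S \<subseteq> ?F u" "card S = k" by auto
      have "(x, y) \<in> parcs (blow_up G w)" if "x \<in> S" "y \<in> S" "x \<noteq> y" for x y
      proof -
        have "x \<in> ?F u" "y \<in> ?F u" using S(1) that by auto
        then show ?thesis
          using adj[of "fst x" "fst y"] \<open>x \<noteq> y\<close>
          by (cases "fst x = fst y") (auto simp: parcs_blow_up_iff pverts_blow_up)
      qed
      moreover have "S \<subseteq> pverts (blow_up G w)"
        using S(1) by (auto simp: pverts_blow_up)
      ultimately show "S \<in> {S. is_clique (blow_up G w) S \<and> finite S \<and> card S = k}"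
        using S finite_subset[OF S(1) finF] by (simp add: is_clique_def)
    qed
  qed
  finally show ?thesis .
qed

lemma complete_multipartite_finite_pverts:
  assumes "complete_multipartite G"
  shows "finite (pverts G)"
proof -
  interpret pair_graph G
    using assms by (simp add: complete_multipartite_def)
  show ?thesis by simp
qed

lemma complete_multipartite_map_to_maximum_independent_set:
  assumes G: "complete_multipartite G" and U: "maximum_independent_set G U"
  obtains \<phi> where "\<phi> ` pverts G \<subseteq> U"
    and "\<And>x y. \<lbrakk>x \<in> pverts G; y \<in> pverts G; x \<noteq> y; \<phi> x = \<phi> y\<rbrakk> \<Longrightarrow> (x, y) \<in> parcs G"
proof -
  have fin: "finite (pverts G)"
    using G by (rule complete_multipartite_finite_pverts)
  have finU: "finite U"
    using U fin by (auto simp: maximum_independent_set_def independent_set_def intro: finite_subset)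
  obtain P where P: "partition_on (pverts G) P"
    and arcs: "\<And>x y. \<lbrakk>x \<in> pverts G; y \<in> pverts G\<rbrakk> \<Longrightarrow>
      (x, y) \<in> parcs G \<longleftrightarrow> (\<exists>I\<in>P. \<exists>J\<in>P. I \<noteq> J \<and> x \<in> I \<and> y \<in> J)"
    using G by (auto simp: complete_multipartite_def)
  have sub: "I \<subseteq> pverts G" if "I \<in> P" for I
    using P that by (auto simp: partition_on_def)
  have unique: "J = I" if "I \<in> P" "J \<in> P" "x \<in> I" "x \<in> J" for I J x
    using P that by (auto simp: partition_on_def disjoint_def)
  have "\<exists>f. inj_on f I \<and> f ` I \<subseteq> U" if I: "I \<in> P" for I
  proof -
    \<comment> \<open>An arc would put its two ends in different partite sets, but each end lies in
      \<open>I\<close> alone.\<close>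
    have "(x, y) \<notin> parcs G" if "x \<in> I" "y \<in> I" for x y
    proof -
      have "x \<in> pverts G" "y \<in> pverts G" using sub[OF I] that by auto
      then show ?thesis using arcs unique[OF I] that by metis
    qed
    then have "independent_set G I"
      using sub[OF I] by (simp add: independent_set_def)
    then have "card I \<le> card U"
      using U by (simp add: maximum_independent_set_def)
    then show ?thesis
      using inj_on_iff_card_le[OF finite_subset[OF sub[OF I] fin] finU] by blast
  qed
  then obtain f where f: "\<And>I. I \<in> P \<Longrightarrow> inj_on (f I) I \<and> f I ` I \<subseteq> U"
    by metis
  have "\<forall>x\<in>pverts G. \<exists>I\<in>P. x \<in> I"
    using P by (auto simp: partition_on_def)
  then obtain p where p: "\<And>x. x \<in> pverts G \<Longrightarrow> p x \<in> P \<and> x \<in> p x"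
    by metis
  show thesis
  \<comment> \<open>Each vertex is sent to \<open>U\<close> by the injection chosen for its own
    partite set \<open>p x\<close>.\<close>
  proof (rule that[of "\<lambda>x. f (p x) x"])
    show "(\<lambda>x. f (p x) x) ` pverts G \<subseteq> U"
      using f p by blast
    show "(x, y) \<in> parcs G"
      if "x \<in> pverts G" "y \<in> pverts G" "x \<noteq> y" "f (p x) x = f (p y) y" for x y
    proof -
      \<comment> \<open>If both vertices lay in one partite set, injectivity there would make them
        equal.\<close>
      have "p x \<noteq> p y"
        using that f p by (metis inj_onD)
      then show ?thesis using arcs that p by blast
    qed
  qed
qed

theorem theorem6:
  fixes G :: "'a pair_pre_digraph" and m k :: nat and w w' :: "'a \<Rightarrow> nat"
  assumes "m \<ge> 1" and "k \<ge> 2"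
    and "complete_multipartite G"
    and "weighting G m w" and "weighting G m w'"
    and "uniform_alpha G m w'"
  shows "num_cliques k (blow_up G w') \<le> num_cliques k (blow_up G w)"
proof -
  obtain j where k: "k = Suc j"
    using assms(2) by (cases k) auto
  obtain U where U: "maximum_independent_set G U" and unif: "uniform_on G m U w'"
    using assms(6) by (auto simp: uniform_alpha_def)
  have fin: "finite (pverts G)"
    using assms(3) by (rule complete_multipartite_finite_pverts)
  have UV: "U \<subseteq> pverts G" and supp: "\<And>v. v \<in> pverts G - U \<Longrightarrow> w' v = 0"
    using unif by (auto simp: uniform_on_def)
  have finU: "finite U"
    using UV fin by (rule finite_subset)
  obtain \<phi> where \<phi>: "\<phi> ` pverts G \<subseteq> U"
    and adj: "\<And>x y. \<lbrakk>x \<in> pverts G; y \<in> pverts G; x \<noteq> y; \<phi> x = \<phi> y\<rbrakk> \<Longrightarrow> (x, y) \<in> parcs G"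
    using complete_multipartite_map_to_maximum_independent_set[OF assms(3) U] by blast
  \<comment> \<open>The push-forward of \<open>w\<close> along \<open>\<phi>\<close>; it has the
    same total weight because the fibres over \<open>U\<close> partition the vertices.\<close>
  define c where "c u = (\<Sum>v\<in>{v \<in> pverts G. \<phi> v = u}. w v)" for u
  have "sum c U = sum w (pverts G)"
    unfolding c_def by (rule sum.group[OF fin finU \<phi>])
  also have "\<dots> = sum w' (pverts G)"
    using assms(4,5) by (simp add: weighting_def)
  also have "\<dots> = sum w' U"
    using supp by (intro sum.mono_neutral_right[OF fin UV]) blast
  finally have "sum w' U = sum c U" ..
  have "num_cliques k (blow_up G w') \<le> (\<Sum>u\<in>U. w' u choose k)"
    using num_cliques_blow_up_independent_le[OF finU _ supp] U k
    by (simp add: maximum_independent_set_def)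
  also have "\<dots> \<le> (\<Sum>u\<in>U. c u choose k)"
    unfolding k using \<open>sum w' U = sum c U\<close> uniform_on_balanced[OF unif]
    by (rule sum_binomial_balanced_le)
  also have "\<dots> \<le> num_cliques k (blow_up G w)"
    unfolding c_def using fin finU adj k by (intro num_cliques_blow_up_fibres_ge) auto
  finally show ?thesis .
qed

end
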